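(* Let $\mathcal{S}=(A,B,C,\mathcal{N},\mathcal{M})$ be a BQO system of order $n$ with $m$ inputs and $p$ outputs, and assume that the algorithm BQO-TSIA (described in the context) applied to $\mathcal{S}$ converges, with output the BQO system $\widehat{\mathcal{S}}^{opt}$ of order $r$ with matrices $\widehat A^{opt},\widehat B^{opt},\widehat C^{opt},\widehat N_k^{opt}$ ($k=1,\dots,m$), $\widehat M_j^{opt}$ ($j=1,\dots,p$). Let $\widehat P,\Psi\in\mathbb{R}^{r\times r}$ and $X,\Pi\in\mathbb{R}^{n\times r}$ be the (assumed unique) solutions of $$\widehat A^{opt}\widehat P+\widehat P(\widehat A^{opt})^T+\sum_{k=1}^m\widehat N_k^{opt}\widehat P(\widehat N_k^{opt})^T+\widehat B^{opt}(\widehat B^{opt})^T=0,$$ $$AX+X(\widehat A^{opt})^T+\sum_{k=1}^mN_kX(\widehat N_k^{opt})^T+B(\widehat B^{opt})^T=0,$$ $$(\widehat A^{opt})^T\Psi+\Psi\widehat A^{opt}+\sum_{k=1}^m(\widehat N_k^{opt})^T\Psi\widehat N_k^{opt}+2\sum_{j=1}^p\widehat M_j^{opt}\widehat P\widehat M_j^{opt}+(\widehat C^{opt})^T\widehat C^{opt}=0,$$ $$A^T\Pi+\Pi\widehat A^{opt}+\sum_{k=1}^mN_k^T\Pi\widehat N_k^{opt}+2\sum_{j=1}^pM_jX\widehat M_j^{opt}+C^T\widehat C^{opt}=0.$$ Then $\widehat{\mathcal{S}}^{opt}$ fulfills the necessary $\mathcal{H}_2$ optimality conditions $$0=\Psi\widehat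 P-\Pi^TX,\quad 0=\Psi\widehat B^{opt}-\Pi^TB,\quad 0=\Psi\widehat N_k^{opt}\widehat P-\Pi^TN_kX,\quad 0=\widehat C^{opt}\widehat P-CX,\quad 0=\widehat P\widehat M_j^{opt}\widehat P-X^TM_jX$$ for all $k=1,\dots,m$ and $j=1,\dots,p$.
   Context: A BQO (bilinear quadratic output) system of order $n$ with $m$ inputs and $p$ outputs is given by real matrices $A\in\mathbb{R}^{n\times n}$, $B\in\mathbb{R}^{n\times m}$, $C\in\mathbb{R}^{p\times n}$, $N_1,\dots,N_m\in\mathbb{R}^{n\times n}$ and symmetric $M_1,\dots,M_p\in\mathbb{R}^{n\times n}$, and represents $\dot x=Ax+\sum_kN_kxu_k+Bu$, $x(0)=0$, $y=Cx+[x^TM_1x,\dots,x^TM_px]^T$; $\mathcal{N}=[N_1\,\dots\,N_m]$, $\mathcal{M}=[M_1\,\dots\,M_p]$. Algorithm BQO-TSIA. Input: $\mathcal{S}$ and an initial BQO system of order $r$ with matrices $\widehat A,\widehat B,\widehat C,\widehat N_k,\widehat M_j$. Repeat until convergence: (i) solve $$AX+X\widehat A^T+\sum_{k=1}^mN_kX\widehat N_k^T+B\widehat B^T=0,\qquad A^T\Pi+\Pi\widehat A+\sum_{k=1}^mN_k^T\Pi\widehat N_k+2\sum_{j=1}^pM_jX\widehat M_j+C^T\widehat C=0$$ for $X,\Pi\in\mathbb{R}^{n\times r}$; (ii) compute $V=\operatorname{orth}(X)$, $W=\operatorname{orth}(\Pi)$, matrices in $\mathbb{R}^{n\times r}$ whose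 columns are orthonormal bases of the column spaces of $X$ and $\Pi$, so that $V=XF$, $W=\Pi G$ with nonsingular $F,G\in\mathbb{R}^{r\times r}$ ($X$ and $\Pi$ have full column rank); (iii) replace the current reduced matrices by $\widehat A=(W^TV)^{-1}W^TAV$, $\widehat B=(W^TV)^{-1}W^TB$, $\widehat C=CV$, $\widehat N_k=(W^TV)^{-1}W^TN_kV$, $\widehat M_j=V^TM_jV$ ($W^TV$ nonsingular). The output $\widehat{\mathcal{S}}^{opt}$ is the last computed reduced system. Convergence: the output $\widehat{\mathcal{S}}^{opt}$, obtained by one pass of (i)–(iii) from the preceding reduced system $(\bar A,\bar B,\bar C,\bar N_k,\bar M_j)$, is a state-space transformation of that preceding system: there is a nonsingular $T\in\mathbb{R}^{r\times r}$ with $\bar A=T^{-1}\widehat A^{opt}T$, $\bar B=T^{-1}\widehat B^{opt}$, $\bar C=\widehat C^{opt}T$, $\bar N_k=T^{-1}\widehat N_k^{opt}T$, $\bar M_j=T^T\widehat M_j^{opt}T$ for all $k,j$. Each of the linear matrix equations above is assumed to have a unique solution. *)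

theory Defs
  imports "HOL-Analysis.Analysis"
begin

text \<open>
  A bilinear system with quadratic output (BQO system)
  \<open>x' = A x + (\<Sum>k. u\<^sub>k N\<^sub>k x) + B u\<close>, \<open>x(0) = 0\<close>, \<open>y = C x + (x\<^sup>T M\<^sub>j x)\<^sub>j\<close>
  is given by its matrices. The index types \<open>'n\<close>, \<open>'m\<close>, \<open>'p\<close> carry the order and the numbers
  of inputs and outputs. Recall that \<open>real^'m^'n\<close> has rows indexed by \<open>'n\<close>, columns by \<open>'m\<close>.
\<close>

record ('n, 'm, 'p) bqo =
  sysA :: "real^'n^'n"
  sysB :: "real^'m^'n"
  sysC :: "real^'n^'p"
  sysN :: "'m \<Rightarrow> real^'n^'n"
  sysM :: "'p \<Rightarrow> real^'n^'n"

definition bqo_system :: "('n::finite, 'm::finite, 'p::finite) bqo \<Rightarrow> bool" where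
  "bqo_system S \<longleftrightarrow> (\<forall>j. transpose (sysM S j) = sysM S j)"

definition state_space_transform ::
  "real^'r^'r \<Rightarrow> ('r::finite, 'm::finite, 'p::finite) bqo \<Rightarrow> ('r, 'm, 'p) bqo" where
  "state_space_transform T R =
    \<lparr> sysA = matrix_inv T ** sysA R ** T,
      sysB = matrix_inv T ** sysB R,
      sysC = sysC R ** T,
      sysN = (\<lambda>k. matrix_inv T ** sysN R k ** T),
      sysM = (\<lambda>j. transpose T ** sysM R j ** T) \<rparr>"

text \<open>
  The two generalized Sylvester equations coupling a system \<open>S\<close> with a reduced system \<open>R\<close>.
  With \<open>S = R\<close> they are the generalized Lyapunov equations of \<open>R\<close>.
\<close>

definition reach_eq ::
  "('n::finite, 'm::finite, 'p::finite) bqo \<Rightarrow> ('r::finite, 'm, 'p) bqo \<Rightarrow> real^'r^'n \<Rightarrow> bool" where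
  "reach_eq S R X \<longleftrightarrow>
    sysA S ** X + X ** transpose (sysA R)
      + (\<Sum>k\<in>UNIV. sysN S k ** X ** transpose (sysN R k))
      + sysB S ** transpose (sysB R) = 0"

definition obs_eq ::
  "('n::finite, 'm::finite, 'p::finite) bqo \<Rightarrow> ('r::finite, 'm, 'p) bqo \<Rightarrow> real^'r^'n \<Rightarrow> real^'r^'n \<Rightarrow> bool"
  where
  "obs_eq S R X Y \<longleftrightarrow>
    transpose (sysA S) ** Y + Y ** sysA R
      + (\<Sum>k\<in>UNIV. transpose (sysN S k) ** Y ** sysN R k)
      + 2 *\<^sub>R (\<Sum>j\<in>UNIV. sysM S j ** X ** sysM R j)
      + transpose (sysC S) ** sysC R = 0"

definition unique_solution :: "('a \<Rightarrow> bool) \<Rightarrow> 'a \<Rightarrow> bool" where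
  "unique_solution E X \<longleftrightarrow> E X \<and> (\<forall>Y. E Y \<longrightarrow> Y = X)"

text \<open>
  \<open>is_orth X V\<close>: \<open>V\<close> is a possible value of \<open>orth(X)\<close>. The number of columns of \<open>V\<close> is that of \<open>X\<close>,
  so this can hold only if \<open>X\<close> has full column rank.
\<close>

definition is_orth :: "real^'r^'n \<Rightarrow> real^'r^'n \<Rightarrow> bool" where
  "is_orth X V \<longleftrightarrow>
    (\<forall>i j. column i V \<bullet> column j V = (if i = j then 1 else 0)) \<and>
    span (columns V) = span (columns X)"

definition projected_system ::
  "('n::finite, 'm::finite, 'p::finite) bqo \<Rightarrow> real^'r^'n \<Rightarrow> real^'r^'n \<Rightarrow> ('r::finite, 'm, 'p) bqo" where
  "projected_system S V W =
    (let E = matrix_inv (transpose W ** V) in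
    \<lparr> sysA = E ** transpose W ** sysA S ** V,
      sysB = E ** transpose W ** sysB S,
      sysC = sysC S ** V,
      sysN = (\<lambda>k. E ** transpose W ** sysN S k ** V),
      sysM = (\<lambda>j. transpose V ** sysM S j ** V) \<rparr>)"

text \<open>
  One pass of the iteration, from the reduced system \<open>R\<close> to the reduced system \<open>R'\<close>. It is a
  relation because the choice of orthonormal bases is free.
\<close>

definition tsia_step ::
  "('n::finite, 'm::finite, 'p::finite) bqo \<Rightarrow> ('r::finite, 'm, 'p) bqo \<Rightarrow> ('r, 'm, 'p) bqo \<Rightarrow> bool" where
  "tsia_step S R R' \<longleftrightarrow>
    (\<exists>X Y V W.
      unique_solution (reach_eq S R) X \<and>
      unique_solution (obs_eq S R X) Y \<and>
      rank X = CARD('r) \<and> rank Y = CARD('r) \<and>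
      is_orth X V \<and> is_orth Y W \<and>
      invertible (transpose W ** V) \<and>
      R' = projected_system S V W)"

text \<open>
  \<open>tsia_converges S R0 R\<close>: started in \<open>R0\<close>, the iteration converges with output \<open>R\<close>, that is,
  the last pass changes the reduced system only by a state-space transformation.
\<close>

definition tsia_converges ::
  "('n::finite, 'm::finite, 'p::finite) bqo \<Rightarrow> ('r::finite, 'm, 'p) bqo \<Rightarrow> ('r, 'm, 'p) bqo \<Rightarrow> bool" where
  "tsia_converges S R0 R \<longleftrightarrow>
    (\<exists>R'. rtranclp (tsia_step S) R0 R' \<and> tsia_step S R' R \<and>
      (\<exists>T. invertible T \<and> R' = state_space_transform T R))"

end

theory Submission
  imports Defs
begin

text \<open>
  At a fixed point of the iteration, the solutions \<open>P\<close>, \<open>\<Psi>\<close> for the reduced system are just \<open>X\<close>,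
  \<open>Y\<close> expressed in the bases used for the projection. Let the last pass use bases \<open>V\<close>, \<open>W\<close>, and put \<open>U = (W\<^sup>T V)\<^sup>-\<^sup>1 W\<^sup>T\<close>, so that \<open>U V = 1\<close>
  and the output is the Petrov-Galerkin projection of \<open>S\<close> with trial matrix \<open>V\<close> and test matrix
  \<open>U\<close>.

  Convergence says that the last two iterates differ by a change of coordinates \<open>T\<close>. Solutions of
  the Sylvester equations follow such a change by right multiplication with \<open>T\<^sup>T\<close> and \<open>T\<^sup>-\<^sup>1\<close>
  (\<open>reach_eq_of_petrov_galerkin_reduced\<close>, \<open>obs_eq_of_petrov_galerkin_reduced\<close>). By uniqueness, the
  solutions \<open>X\<close>, \<open>Y\<close> that belong to the output therefore have the same column spaces as those
  from which \<open>V\<close>, \<open>W\<close> were computed. Hence the oblique projector \<open>V U\<close> fixes \<open>X\<close>, and its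
  transpose fixes \<open>Y\<close>.

  Because of this, multiplying the Sylvester equations from the left by \<open>U\<close> and \<open>V\<^sup>T\<close> turns them
  into the Lyapunov equations of the output, with solutions \<open>U X\<close> and \<open>V\<^sup>T Y\<close>
  (\<open>reach_eq_petrov_galerkin\<close>, \<open>obs_eq_petrov_galerkin\<close>). Uniqueness gives \<open>P = U X\<close> and
  \<open>\<Psi> = V\<^sup>T Y\<close>, that is, \<open>X = V P\<close> and, since \<open>\<Psi>\<close> is symmetric, \<open>\<Psi> U = Y\<^sup>T\<close>. Substituting these
  into \<open>\<Psi> P\<close>, \<open>\<Psi> U B\<close>, \<open>\<Psi> U N\<^sub>k V P\<close>, \<open>C V P\<close> and \<open>P V\<^sup>T M\<^sub>j V P\<close> yields the optimality conditions.
\<close>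

section \<open>Matrix algebra\<close>

lemma matrix_add_rdistrib: "(A + B) ** C = A ** C + (B ** C :: real^'c^'a)"
  by (simp add: matrix_matrix_mult_def vec_eq_iff sum.distrib distrib_right)

lemma matrix_mult_sum_right:
  fixes A :: "real^'b^'a::finite"
  shows "A ** (\<Sum>i\<in>I. f i) = (\<Sum>i\<in>I. A ** f i)"
  by (induction I rule: infinite_finite_induct) (simp_all add: matrix_add_ldistrib)

lemma matrix_mult_sum_left:
  fixes A :: "real^'b^'a::finite"
  shows "(\<Sum>i\<in>I. f i) ** A = (\<Sum>i\<in>I. f i ** A)"
  by (induction I rule: infinite_finite_induct) (simp_all add: matrix_add_rdistrib)

lemma transpose_add: "transpose (A + B) = transpose A + transpose (B :: real^'b^'a)"
  by (simp add: transpose_def vec_eq_iff)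

lemma transpose_zero: "transpose (0 :: real^'b^'a) = 0"
  by (simp add: transpose_def vec_eq_iff)

lemma transpose_sum:
  "transpose (\<Sum>i\<in>I. f i :: real^'b^'a) = (\<Sum>i\<in>I. transpose (f i))"
  by (induction I rule: infinite_finite_induct) (simp_all add: transpose_add transpose_zero)

lemma matrix_mult_scaleR_right: "A ** (c *\<^sub>R B) = c *\<^sub>R (A ** (B :: real^'c^'b))"
  by (simp add: matrix_matrix_mult_def vec_eq_iff sum_distrib_left mult.left_commute)

lemma matrix_mult_scaleR_left: "(c *\<^sub>R A) ** B = c *\<^sub>R (A ** (B :: real^'c^'b))"
  by (simp add: matrix_matrix_mult_def vec_eq_iff sum_distrib_left mult.assoc)

lemmas matrix_expand =
  matrix_add_ldistrib matrix_add_rdistrib matrix_mult_sum_left matrix_mult_sum_right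
  matrix_mult_scaleR_left matrix_mult_scaleR_right matrix_transpose_mul matrix_mul_assoc

lemma matrix_inv_right_left:
  assumes "invertible A"
  shows "A ** matrix_inv A = mat 1" and "matrix_inv A ** A = mat 1"
proof -
  from assms obtain B where "A ** B = mat 1 \<and> B ** A = mat 1"
    unfolding invertible_def by blast
  then have "A ** matrix_inv A = mat 1 \<and> matrix_inv A ** A = mat 1"
    unfolding matrix_inv_def by (rule someI)
  then show "A ** matrix_inv A = mat 1" and "matrix_inv A ** A = mat 1"
    by simp_all
qed

lemma factor_through_column_space:
  fixes X V :: "real^'r::finite^'n::finite"
  assumes "columns X \<subseteq> span (columns V)"
  shows "\<exists>K :: real^'r^'r. X = V ** K"
proof -
  have "columns V \<subseteq> range ((*v) V)"
    by (auto simp: columns_def matrix_vector_mult_basis [symmetric])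
  moreover have "subspace (range ((*v) V))"
    by (intro linear_subspace_image) auto
  ultimately have "columns X \<subseteq> range ((*v) V)"
    using assms span_minimal by blast
  then have "\<forall>i. \<exists>k. column i X = V *v k"
    by (auto simp: columns_def)
  then obtain k where k: "\<And>i. column i X = V *v k i"
    by metis
  have "X = V ** transpose (\<chi> i. k i)"
    using k by (simp add: vec_eq_iff column_def matrix_matrix_mult_def matrix_vector_mult_def
        transpose_def)
  then show ?thesis ..
qed

lemma is_orth_factor:
  fixes X V :: "real^'r::finite^'n::finite"
  assumes "is_orth X V"
  shows "\<exists>K :: real^'r^'r. X = V ** K"
  using assms factor_through_column_space[of X V] span_superset[of "columns X"]
  by (simp add: is_orth_def)

section \<open>Petrov-Galerkin projection\<close>

text \<open>
  Both the projection step of the iteration and a change of state coordinates have this form; in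
  the first case the test matrix is only a left inverse of the trial matrix, in the second case it
  is a two-sided inverse.
\<close>

definition petrov_galerkin ::
  "real^'r^'n \<Rightarrow> real^'n^'r \<Rightarrow> ('n::finite, 'm::finite, 'p::finite) bqo \<Rightarrow> ('r::finite, 'm, 'p) bqo"
  where
  "petrov_galerkin V U S =
    \<lparr> sysA = U ** sysA S ** V,
      sysB = U ** sysB S,
      sysC = sysC S ** V,
      sysN = (\<lambda>k. U ** sysN S k ** V),
      sysM = (\<lambda>j. transpose V ** sysM S j ** V) \<rparr>"

lemma petrov_galerkin_simps:
  "sysA (petrov_galerkin V U S) = U ** sysA S ** V"
  "sysB (petrov_galerkin V U S) = U ** sysB S"
  "sysC (petrov_galerkin V U S) = sysC S ** V"
  "sysN (petrov_galerkin V U S) k = U ** sysN S k ** V"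
  "sysM (petrov_galerkin V U S) j = transpose V ** sysM S j ** V"
  by (simp_all add: petrov_galerkin_def)

lemma state_space_transform_eq_petrov_galerkin:
  "state_space_transform T R = petrov_galerkin T (matrix_inv T) R"
  by (simp add: state_space_transform_def petrov_galerkin_def)

lemma projected_system_eq_petrov_galerkin:
  "projected_system S V W = petrov_galerkin V (matrix_inv (transpose W ** V) ** transpose W) S"
  by (simp add: projected_system_def petrov_galerkin_def Let_def)

lemma bqo_system_petrov_galerkin: "bqo_system S \<Longrightarrow> bqo_system (petrov_galerkin V U S)"
  by (simp add: bqo_system_def petrov_galerkin_simps matrix_transpose_mul matrix_mul_assoc)

section \<open>Change of coordinates in the reduced system\<close>

text \<open>
  Multiply the equation from the right by \<open>T\<^sup>T\<close>: every transposed matrix of the transformed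
  system ends in a factor \<open>U\<^sup>T\<close>, which this cancels.
\<close>

lemma reach_eq_of_petrov_galerkin_reduced:
  fixes S :: "('n::finite, 'm::finite, 'p::finite) bqo" and R :: "('s::finite, 'm, 'p) bqo"
    and T :: "real^'r::finite^'s" and U :: "real^'s^'r"
  assumes TU: "T ** U = mat 1"
    and eq: "reach_eq S (petrov_galerkin T U R) X"
  shows "reach_eq S R (X ** transpose T)"
proof -
  have "transpose U ** transpose T = mat 1"
    by (metis TU matrix_transpose_mul transpose_mat)
  then have cancel: "Z ** transpose U ** transpose T = Z" for Z :: "real^'s^'d"
    by (metis matrix_mul_assoc matrix_mul_rid)
  from eq have "(sysA S ** X + X ** transpose (U ** sysA R ** T)
      + (\<Sum>k\<in>UNIV. sysN S k ** X ** transpose (U ** sysN R k ** T))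
      + sysB S ** transpose (U ** sysB R)) ** transpose T = 0"
    by (simp add: reach_eq_def petrov_galerkin_simps)
  then show ?thesis
    by (simp add: reach_eq_def matrix_expand cancel)
qed

text \<open>Dually, the factor to cancel is \<open>T\<close>, by multiplication with \<open>U\<close> from the right.\<close>

lemma obs_eq_of_petrov_galerkin_reduced:
  fixes S :: "('n::finite, 'm::finite, 'p::finite) bqo" and R :: "('s::finite, 'm, 'p) bqo"
    and T :: "real^'r::finite^'s" and U :: "real^'s^'r"
  assumes TU: "T ** U = mat 1"
    and eq: "obs_eq S (petrov_galerkin T U R) X Y"
  shows "obs_eq S R (X ** transpose T) (Y ** U)"
proof -
  have cancel: "Z ** T ** U = Z" for Z :: "real^'s^'d"
    by (metis TU matrix_mul_assoc matrix_mul_rid)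
  from eq have "(transpose (sysA S) ** Y + Y ** (U ** sysA R ** T)
      + (\<Sum>k\<in>UNIV. transpose (sysN S k) ** Y ** (U ** sysN R k ** T))
      + 2 *\<^sub>R (\<Sum>j\<in>UNIV. sysM S j ** X ** (transpose T ** sysM R j ** T))
      + transpose (sysC S) ** (sysC R ** T)) ** U = 0"
    by (simp add: obs_eq_def petrov_galerkin_simps)
  then show ?thesis
    by (simp add: obs_eq_def matrix_expand cancel)
qed

section \<open>Projection of the full system\<close>

text \<open>
  Multiply the equation from the left by \<open>U\<close> and insert the projector \<open>V U\<close> in front of \<open>X\<close>.
\<close>

lemma reach_eq_petrov_galerkin:
  fixes S :: "('n::finite, 'm::finite, 'p::finite) bqo" and R :: "('r::finite, 'm, 'p) bqo"
    and V :: "real^'q::finite^'n" and U :: "real^'n^'q"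
  assumes fixX: "V ** U ** X = X"
    and eq: "reach_eq S R X"
  shows "reach_eq (petrov_galerkin V U S) R (U ** X)"
proof -
  have insert: "Z ** V ** U ** X = Z ** X" for Z :: "real^'n^'d"
    by (metis fixX matrix_mul_assoc)
  from eq have "U ** (sysA S ** X + X ** transpose (sysA R)
      + (\<Sum>k\<in>UNIV. sysN S k ** X ** transpose (sysN R k))
      + sysB S ** transpose (sysB R)) = 0"
    by (simp add: reach_eq_def)
  then show ?thesis
    by (simp add: reach_eq_def petrov_galerkin_simps matrix_expand insert)
qed

text \<open>
  Here the equation is multiplied from the left by \<open>V\<^sup>T\<close>, and the transposed projector is inserted
  in front of \<open>Y\<close>. The quadratic term still needs \<open>V U X = X\<close>, as it is the projected matrix
  \<open>V\<^sup>T M\<^sub>j V\<close> that must appear in front of \<open>U X\<close>.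
\<close>

lemma obs_eq_petrov_galerkin:
  fixes S :: "('n::finite, 'm::finite, 'p::finite) bqo" and R :: "('r::finite, 'm, 'p) bqo"
    and V :: "real^'q::finite^'n" and U :: "real^'n^'q"
  assumes fixX: "V ** U ** X = X"
    and fixY: "transpose (V ** U) ** Y = Y"
    and eq: "obs_eq S R X Y"
  shows "obs_eq (petrov_galerkin V U S) R (U ** X) (transpose V ** Y)"
proof -
  have insertX: "Z ** V ** U ** X = Z ** X" for Z :: "real^'n^'d"
    by (metis fixX matrix_mul_assoc)
  have insertY: "Z ** transpose U ** transpose V ** Y = Z ** Y" for Z :: "real^'n^'d"
    by (metis fixY matrix_transpose_mul matrix_mul_assoc)
  from eq have "transpose V ** (transpose (sysA S) ** Y + Y ** sysA R
      + (\<Sum>k\<in>UNIV. transpose (sysN S k) ** Y ** sysN R k)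
      + 2 *\<^sub>R (\<Sum>j\<in>UNIV. sysM S j ** X ** sysM R j)
      + transpose (sysC S) ** sysC R) = 0"
    by (simp add: obs_eq_def)
  then show ?thesis
    by (simp add: obs_eq_def petrov_galerkin_simps matrix_expand insertX insertY)
qed

section \<open>Symmetry of the Gramians\<close>

text \<open>
  Transposition maps solutions of a Lyapunov equation to solutions, so a unique solution is
  symmetric. For the observability equation this uses that the matrices of the quadratic output
  and the Gramian \<open>P\<close> inside it are symmetric.
\<close>

lemma reach_gramian_symmetric:
  assumes "unique_solution (reach_eq R R) P"
  shows "transpose P = P"
proof -
  have "reach_eq R R P"
    using assms by (simp only: unique_solution_def)
  then have "transpose (sysA R ** P + P ** transpose (sysA R)
      + (\<Sum>k\<in>UNIV. sysN R k ** P ** transpose (sysN R k))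
      + sysB R ** transpose (sysB R)) = 0"
    by (simp add: reach_eq_def transpose_zero)
  then have "reach_eq R R (transpose P)"
    by (simp add: reach_eq_def transpose_add transpose_sum matrix_transpose_mul matrix_mul_assoc
        add_ac)
  with assms show ?thesis
    unfolding unique_solution_def by blast
qed

lemma obs_gramian_symmetric:
  assumes sym: "bqo_system R" "transpose P = P"
    and sol: "unique_solution (obs_eq R R P) \<Psi>"
  shows "transpose \<Psi> = \<Psi>"
proof -
  have "obs_eq R R P \<Psi>"
    using sol by (simp only: unique_solution_def)
  then have "transpose (transpose (sysA R) ** \<Psi> + \<Psi> ** sysA R
      + (\<Sum>k\<in>UNIV. transpose (sysN R k) ** \<Psi> ** sysN R k)
      + 2 *\<^sub>R (\<Sum>j\<in>UNIV. sysM R j ** P ** sysM R j)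
      + transpose (sysC R) ** sysC R) = 0"
    by (simp add: obs_eq_def transpose_zero)
  then have "obs_eq R R P (transpose \<Psi>)"
    using sym by (simp add: bqo_system_def obs_eq_def transpose_add transpose_sum transpose_scalar
        matrix_transpose_mul matrix_mul_assoc add_ac)
  with sol show ?thesis
    unfolding unique_solution_def by blast
qed

section \<open>Fixed points of the iteration\<close>

text \<open>
  What convergence provides: uniqueness identifies \<open>X\<close> and \<open>Y\<close> with coordinate changes of the
  solutions used in the last pass, so their columns lie in the spaces spanned by \<open>V\<close> and \<open>W\<close>. These
  are the range of the projector \<open>V U\<close> and of its transpose.
\<close>

lemma tsia_converges_projection:
  fixes S :: "('n::finite, 'm::finite, 'p::finite) bqo"
    and S0 Sopt :: "('r::finite, 'm, 'p) bqo"
  assumes conv: "tsia_converges S S0 Sopt"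
    and X: "unique_solution (reach_eq S Sopt) X"
    and Y: "unique_solution (obs_eq S Sopt X) Y"
  obtains V :: "real^'r^'n" and U :: "real^'n^'r"
  where "Sopt = petrov_galerkin V U S"
    and "V ** U ** X = X"
    and "transpose (V ** U) ** Y = Y"
proof -
  from conv obtain R T where step: "tsia_step S R Sopt" and T: "invertible T"
    and R: "R = petrov_galerkin T (matrix_inv T) Sopt"
    by (auto simp: tsia_converges_def state_space_transform_eq_petrov_galerkin)
  from step obtain X' Y' V W where X': "reach_eq S R X'" and Y': "obs_eq S R X' Y'"
    and V: "is_orth X' V" and W: "is_orth Y' W" and inv: "invertible (transpose W ** V)"
    and Sopt: "Sopt = projected_system S V W"
    unfolding tsia_step_def unique_solution_def by blast
  have TU: "T ** matrix_inv T = mat 1"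
    using T by (rule matrix_inv_right_left)
  have X_eq: "X = X' ** transpose T"
    using X reach_eq_of_petrov_galerkin_reduced[OF TU] X' R by (metis unique_solution_def)
  have Y_eq: "Y = Y' ** matrix_inv T"
    using Y obs_eq_of_petrov_galerkin_reduced[OF TU] Y' R X_eq by (metis unique_solution_def)
  obtain K where K: "X = V ** K"
    using is_orth_factor[OF V] X_eq by (metis matrix_mul_assoc)
  obtain L where L: "Y = W ** L"
    using is_orth_factor[OF W] Y_eq by (metis matrix_mul_assoc)
  define E where "E = matrix_inv (transpose W ** V)"
  have left: "E ** transpose W ** V = mat 1"
    using matrix_inv_right_left(2)[OF inv] by (simp add: E_def matrix_mul_assoc)
  have right: "transpose W ** V ** E = mat 1"
    using matrix_inv_right_left(1)[OF inv] by (simp add: E_def)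
  define U where "U = E ** transpose W"
  show thesis
  proof
    show "Sopt = petrov_galerkin V U S"
      by (simp add: Sopt projected_system_eq_petrov_galerkin U_def E_def)
    show "V ** U ** X = X"
      by (metis K U_def left matrix_mul_assoc matrix_mul_rid)
    have "transpose W ** (V ** U) = transpose W"
      by (metis U_def right matrix_mul_assoc matrix_mul_lid)
    then have "transpose (V ** U) ** W = W"
      by (metis matrix_transpose_mul transpose_transpose)
    then show "transpose (V ** U) ** Y = Y"
      by (simp add: L matrix_mul_assoc)
  qed
qed

theorem theorem5p3:
  fixes S :: "('n::finite, 'm::finite, 'p::finite) bqo"
    and S0 Sopt :: "('r::finite, 'm, 'p) bqo"
    and P \<Psi> :: "real^'r^'r"
    and X Y :: "real^'r^'n"
  assumes "bqo_system S"
    and "bqo_system S0"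
    and "tsia_converges S S0 Sopt"
    and "unique_solution (reach_eq Sopt Sopt) P"
    and "unique_solution (reach_eq S Sopt) X"
    and "unique_solution (obs_eq Sopt Sopt P) \<Psi>"
    and "unique_solution (obs_eq S Sopt X) Y"
  shows "0 = \<Psi> ** P - transpose Y ** X
    \<and> 0 = \<Psi> ** sysB Sopt - transpose Y ** sysB S
    \<and> (\<forall>k. 0 = \<Psi> ** sysN Sopt k ** P - transpose Y ** sysN S k ** X)
    \<and> 0 = sysC Sopt ** P - sysC S ** X
    \<and> (\<forall>j. 0 = P ** sysM Sopt j ** P - transpose X ** sysM S j ** X)"
proof -
  obtain V :: "real^'r^'n" and U :: "real^'n^'r"
    where Sopt: "Sopt = petrov_galerkin V U S"
      and fixX: "V ** U ** X = X" and fixY: "transpose (V ** U) ** Y = Y"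
    using tsia_converges_projection[OF assms(3,5,7)] by blast
  have P: "P = U ** X"
    using assms(4,5) reach_eq_petrov_galerkin[OF fixX] Sopt by (metis unique_solution_def)
  have \<Psi>: "\<Psi> = transpose V ** Y"
    using assms(6,7) obs_eq_petrov_galerkin[OF fixX fixY] Sopt P by (metis unique_solution_def)
  have symP: "transpose P = P"
    using assms(4) by (rule reach_gramian_symmetric)
  have "bqo_system Sopt"
    using assms(1) Sopt by (simp add: bqo_system_petrov_galerkin)
  then have "transpose \<Psi> = \<Psi>"
    using symP assms(6) by (rule obs_gramian_symmetric)
  then have \<Psi>': "\<Psi> = transpose Y ** V"
    by (simp add: \<Psi> matrix_transpose_mul)
  have X: "X = V ** P"
    by (simp add: P matrix_mul_assoc fixX)
  have XT: "transpose X = P ** transpose V"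
    by (metis X matrix_transpose_mul symP)
  have Y: "\<Psi> ** U = transpose Y"
    by (metis \<Psi>' fixY matrix_mul_assoc matrix_transpose_mul transpose_transpose)
  have "\<Psi> ** P = transpose Y ** X"
    by (simp add: \<Psi>' X matrix_mul_assoc)
  moreover have "\<Psi> ** sysB Sopt = transpose Y ** sysB S"
    by (simp add: Sopt petrov_galerkin_simps matrix_mul_assoc Y)
  moreover have "\<Psi> ** sysN Sopt k ** P = transpose Y ** sysN S k ** X" for k
    by (simp add: Sopt petrov_galerkin_simps matrix_mul_assoc Y X)
  moreover have "sysC Sopt ** P = sysC S ** X"
    by (simp add: Sopt petrov_galerkin_simps matrix_mul_assoc X)
  moreover have "P ** sysM Sopt j ** P = transpose X ** sysM S j ** X" for j
    unfolding XT by (simp add: Sopt petrov_galerkin_simps matrix_mul_assoc X)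
  ultimately show ?thesis
    by simp
qed

end
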